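(* Let $K$ be a field and let $\mathcal P$ be a stack polyomino. Then the reduced Gröbner basis of $I_{\mathcal P}$ with respect to each of the two monomial orders $<^1_{\mathrm{lex}}$ and $<^2_{\mathrm{lex}}$ consists (up to sign of its elements) of all inner 2-minors of $\mathcal P$.
   Context: Order $\mathbb N^2$ by $(i,j)\le(k,l)$ iff $i\le k$ and $j\le l$; for $a\le b$ let $[a,b]=\{c: a\le c\le b\}$. For $a=(i,j)$, $b=(k,l)$ with $i<k$, $j<l$ the interval $[a,b]$ is proper, with anti-diagonal corners $c=(k,j)$, $d=(i,l)$. A cell with lower left corner $a$ is $C=[a,a+(1,1)]$, with set of four vertices $V(C)$. A cell with lower left corner $(r,s)$ belongs to $[(i,j),(k,l)]$ if $i\le r\le k-1$, $j\le s\le l-1$. A collection of cells $\mathcal P$ is a finite set of cells; $V(\mathcal P)=\bigcup_{C\in\mathcal P}V(C)$. It is row convex if whenever the cells with lower left corners $(i,j)$ and $(k,j)$, $i\le k$, are in $\mathcal P$, so are all cells with lower left corner $(r,j)$, $i\le r\le k$; column convex is analogous; convex means both. A stack polyomino is a convex collection of cells $\mathcal P=\bigcup_{i=1}^r[A_i,B_i]$, where each $[A_i,B_i]$ is a vertical cell interval (the set of all cells in one column between $A_i$ at the bottom and $B_i$ at the top) and the lower left corner $a_i$ of $A_i$ is $a_i=a_1+(i-1,0)$ (i.e. a row convex bargraph). A proper interval $[a,b]$ is an inner interval of $\mathcal P$ if all cells belonging to it are in $\mathcal P$; then $f_{a,b}=x_ax_b-x_cx_d$ is an inner 2-minor. $S=K[x_a:a\in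 V(\mathcal P)]$, and $I_{\mathcal P}\subset S$ is the ideal generated by all inner 2-minors. $<^1_{\mathrm{lex}}$ is the lexicographic order on $S$ induced by: $x_a>x_b$ for $a=(i,j)$, $b=(k,l)$ if $i>k$, or $i=k$ and $j>l$. $<^2_{\mathrm{lex}}$ is the lexicographic order induced by: $x_a>x_b$ if $i<k$, or $i=k$ and $j>l$. *)

theory Defs
  imports "HOL-Library.Poly_Mapping"
begin

type_synonym point = "nat \<times> nat"

text \<open>A cell is represented by its lower left corner, hence a collection of cells by a
  finite set of points.\<close>

type_synonym cell = point

definition cell_vertices :: "cell \<Rightarrow> point set" where
  "cell_vertices C = (case C of (i, j) \<Rightarrow> {(i, j), (i + 1, j), (i, j + 1), (i + 1, j + 1)})"

definition vertices :: "cell set \<Rightarrow> point set" where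
  "vertices P = (\<Union>C\<in>P. cell_vertices C)"

definition row_convex :: "cell set \<Rightarrow> bool" where
  "row_convex P \<longleftrightarrow>
    (\<forall>i k j. i \<le> k \<and> (i, j) \<in> P \<and> (k, j) \<in> P \<longrightarrow> (\<forall>r. i \<le> r \<and> r \<le> k \<longrightarrow> (r, j) \<in> P))"

definition column_convex :: "cell set \<Rightarrow> bool" where
  "column_convex P \<longleftrightarrow>
    (\<forall>i j l. j \<le> l \<and> (i, j) \<in> P \<and> (i, l) \<in> P \<longrightarrow> (\<forall>s. j \<le> s \<and> s \<le> l \<longrightarrow> (i, s) \<in> P))"

definition vertical_cell_interval :: "nat \<Rightarrow> nat \<Rightarrow> nat \<Rightarrow> cell set" where
  "vertical_cell_interval k j l = {(k, s) | s. j \<le> s \<and> s \<le> l}"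

text \<open>The lower left corner of the bottom cell of the first column is \<open>(i0, j0)\<close>; the top
  cell of the \<open>i\<close>-th column has lower left corner \<open>(i0 + (i - 1), t i)\<close>.
  There is at least one column.\<close>

definition stack_polyomino :: "cell set \<Rightarrow> bool" where
  "stack_polyomino P \<longleftrightarrow> finite P \<and> row_convex P \<and> column_convex P \<and>
    (\<exists>r i0 j0 t. 1 \<le> r \<and> (\<forall>i\<in>{1..r}. j0 \<le> t i) \<and>
       P = (\<Union>i\<in>{1..r}. vertical_cell_interval (i0 + (i - 1)) j0 (t i)))"

definition proper_interval :: "point \<Rightarrow> point \<Rightarrow> bool" where
  "proper_interval a b \<longleftrightarrow> fst a < fst b \<and> snd a < snd b"

definition interval_cells :: "point \<Rightarrow> point \<Rightarrow> cell set" where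
  "interval_cells a b =
    {(r, s). fst a \<le> r \<and> r + 1 \<le> fst b \<and> snd a \<le> s \<and> s + 1 \<le> snd b}"

definition inner_interval :: "cell set \<Rightarrow> point \<Rightarrow> point \<Rightarrow> bool" where
  "inner_interval P a b \<longleftrightarrow> proper_interval a b \<and> interval_cells a b \<subseteq> P"

text \<open>Monomials are exponent vectors in the variables indexed by all points. The polynomial
  ring in the variables indexed by a set \<open>V\<close> is a subring of the polynomials in all of these
  variables, and ideals of this subring are formed with coefficients from it only.\<close>

type_synonym mono = "point \<Rightarrow>\<^sub>0 nat"
type_synonym 'k mpoly = "mono \<Rightarrow>\<^sub>0 'k"

definition poly_ring :: "point set \<Rightarrow> 'k::field mpoly set" where
  "poly_ring V = {p. \<forall>m\<in>Poly_Mapping.keys p. Poly_Mapping.keys m \<subseteq> V}"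

definition monomial :: "mono \<Rightarrow> 'k::field mpoly" where
  "monomial m = Poly_Mapping.single m 1"

definition var :: "point \<Rightarrow> 'k::field mpoly" where
  "var a = monomial (Poly_Mapping.single a 1)"

definition ideal_generated :: "point set \<Rightarrow> 'k::field mpoly set \<Rightarrow> 'k mpoly set" where
  "ideal_generated V F =
    {\<Sum>f\<in>A. q f * f | A q. finite A \<and> A \<subseteq> F \<and> (\<forall>f\<in>A. q f \<in> poly_ring V)}"

definition minor :: "point \<Rightarrow> point \<Rightarrow> 'k::field mpoly" where
  "minor a b = var a * var b - var (fst b, snd a) * var (fst a, snd b)"

definition inner_minors :: "cell set \<Rightarrow> 'k::field mpoly set" where
  "inner_minors P = {minor a b | a b. inner_interval P a b}"

definition polyomino_ideal :: "cell set \<Rightarrow> 'k::field mpoly set" where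
  "polyomino_ideal P = ideal_generated (vertices P) (inner_minors P)"

text \<open>\<open>var_gt1 a b\<close> and \<open>var_gt2 a b\<close> mean that the variable of \<open>a\<close> is greater than
  that of \<open>b\<close>.\<close>

definition var_gt1 :: "point \<Rightarrow> point \<Rightarrow> bool" where
  "var_gt1 a b \<longleftrightarrow> fst a > fst b \<or> (fst a = fst b \<and> snd a > snd b)"

definition var_gt2 :: "point \<Rightarrow> point \<Rightarrow> bool" where
  "var_gt2 a b \<longleftrightarrow> fst a < fst b \<or> (fst a = fst b \<and> snd a > snd b)"

text \<open>\<open>lex_less gt u v\<close>: at the greatest variable where the exponents of \<open>u\<close> and \<open>v\<close> differ,
  that of \<open>u\<close> is smaller.\<close>

definition lex_less :: "(point \<Rightarrow> point \<Rightarrow> bool) \<Rightarrow> mono \<Rightarrow> mono \<Rightarrow> bool" where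
  "lex_less gt u v \<longleftrightarrow>
    (\<exists>a. Poly_Mapping.lookup u a < Poly_Mapping.lookup v a \<and>
         (\<forall>b. gt b a \<longrightarrow> Poly_Mapping.lookup u b = Poly_Mapping.lookup v b))"

definition mono_divides :: "mono \<Rightarrow> mono \<Rightarrow> bool" where
  "mono_divides u v \<longleftrightarrow> (\<forall>a. Poly_Mapping.lookup u a \<le> Poly_Mapping.lookup v a)"

text \<open>In what follows, \<open>lt\<close> is a strict monomial order. The leading monomial is only
  meaningful for nonzero polynomials.\<close>

definition lead_mono :: "(mono \<Rightarrow> mono \<Rightarrow> bool) \<Rightarrow> 'k::field mpoly \<Rightarrow> mono" where
  "lead_mono lt p = (THE m. m \<in> Poly_Mapping.keys p \<and>
     (\<forall>m'\<in>Poly_Mapping.keys p. m' \<noteq> m \<longrightarrow> lt m' m))"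

definition leading_coeff :: "(mono \<Rightarrow> mono \<Rightarrow> bool) \<Rightarrow> 'k::field mpoly \<Rightarrow> 'k" where
  "leading_coeff lt p = Poly_Mapping.lookup p (lead_mono lt p)"

definition initial_ideal ::
  "(mono \<Rightarrow> mono \<Rightarrow> bool) \<Rightarrow> point set \<Rightarrow> 'k::field mpoly set \<Rightarrow> 'k mpoly set" where
  "initial_ideal lt V F = ideal_generated V {monomial (lead_mono lt f) | f. f \<in> F \<and> f \<noteq> 0}"

definition groebner_basis ::
  "(mono \<Rightarrow> mono \<Rightarrow> bool) \<Rightarrow> point set \<Rightarrow> 'k::field mpoly set \<Rightarrow> 'k mpoly set \<Rightarrow> bool" where
  "groebner_basis lt V I G \<longleftrightarrow>
    finite G \<and> 0 \<notin> G \<and> G \<subseteq> I \<and> initial_ideal lt V G = initial_ideal lt V I"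

definition reduced_groebner_basis ::
  "(mono \<Rightarrow> mono \<Rightarrow> bool) \<Rightarrow> point set \<Rightarrow> 'k::field mpoly set \<Rightarrow> 'k mpoly set \<Rightarrow> bool" where
  "reduced_groebner_basis lt V I G \<longleftrightarrow> groebner_basis lt V I G \<and>
    (\<forall>g\<in>G. leading_coeff lt g = 1) \<and>
    (\<forall>g\<in>G. \<forall>h\<in>G. h \<noteq> g \<longrightarrow>
       (\<forall>m\<in>Poly_Mapping.keys g. \<not> mono_divides (lead_mono lt h) m))"

definition equal_up_to_sign :: "'k::field mpoly set \<Rightarrow> 'k mpoly set \<Rightarrow> bool" where
  "equal_up_to_sign G M \<longleftrightarrow> (\<exists>\<sigma>. (\<forall>f\<in>M. \<sigma> f = f \<or> \<sigma> f = - f) \<and> G = \<sigma> ` M)"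

end

(* Every polynomial of the ideal has coefficient sum zero over each set of monomials with
   prescribed row and column sums, because this holds for monomial multiples of inner minors.
   Hence, if m is the leading monomial of f in the ideal, then f contains a smaller monomial m'
   with the same row and column sums. Let (k, l) be the greatest variable at which m' and m
   differ, so m' has the smaller exponent there. As the bottom of the polyomino is flat, the
   vertices in the rows from l upwards lie in the columns that reach row l. If m had no variable
   below row l in such a column that comes after k in the variable order, then the rows from l
   upwards would have a larger exponent sum in m than in m'. So m has such a variable (c, j), and
   then the columns c, k and the rows j, l bound an inner interval whose minor has a leading
   monomial dividing m. *)

theory Submission
  imports Defs
begin

section \<open>Ideals generated inside a polynomial ring\<close>

lemma sum_singles:
  "p = (\<Sum>u\<in>Poly_Mapping.keys p. Poly_Mapping.single u (Poly_Mapping.lookup p u))"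
  by (rule poly_mapping_eqI)
    (simp add: lookup_sum lookup_single when_def in_keys_iff if_distrib cong: if_cong)

lemma poly_ring_zero [simp]: "0 \<in> poly_ring V"
  and poly_ring_one [simp]: "1 \<in> poly_ring V"
  by (auto simp: poly_ring_def)

lemma poly_ring_uminus [simp]: "- p \<in> poly_ring V \<longleftrightarrow> p \<in> poly_ring V"
  by (simp add: poly_ring_def)

lemma poly_ring_add: "p \<in> poly_ring V \<Longrightarrow> q \<in> poly_ring V \<Longrightarrow> p + q \<in> poly_ring V"
  using keys_add[of p q] by (fastforce simp: poly_ring_def)

lemma poly_ring_diff: "p \<in> poly_ring V \<Longrightarrow> q \<in> poly_ring V \<Longrightarrow> p - q \<in> poly_ring V"
  using keys_diff[of p q] by (fastforce simp: poly_ring_def)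

lemma poly_ring_mult:
  assumes "p \<in> poly_ring V" "q \<in> poly_ring V"
  shows "p * q \<in> poly_ring V"
  unfolding poly_ring_def
proof safe
  fix m a b assume m: "m \<in> Poly_Mapping.keys (p * q)" "(a, b) \<in> Poly_Mapping.keys m"
  then obtain u v where "u \<in> Poly_Mapping.keys p" "v \<in> Poly_Mapping.keys q" "m = u + v"
    using keys_mult[of p q] by blast
  with m keys_add[of u v] assms show "(a, b) \<in> V"
    by (fastforce simp: poly_ring_def)
qed

lemma poly_ring_sum: "(\<And>i. i \<in> A \<Longrightarrow> p i \<in> poly_ring V) \<Longrightarrow> sum p A \<in> poly_ring V"
  by (induction A rule: infinite_finite_induct) (auto intro: poly_ring_add)

lemma monomial_in_poly_ring [simp]:
  "(monomial m :: 'k::field mpoly) \<in> poly_ring V \<longleftrightarrow> Poly_Mapping.keys m \<subseteq> V"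
  by (simp add: poly_ring_def monomial_def)

lemma monomial_mult: "(monomial (u + v) :: 'k::field mpoly) = monomial u * monomial v"
  by (simp add: monomial_def mult_single)

lemma ideal_generated_subset_poly_ring:
  "F \<subseteq> poly_ring V \<Longrightarrow> ideal_generated V F \<subseteq> poly_ring V"
  by (auto simp: ideal_generated_def intro!: poly_ring_sum poly_ring_mult)

lemma ideal_generated_zero: "0 \<in> ideal_generated V F"
  unfolding ideal_generated_def by (rule CollectI, rule exI[of _ "{}"]) auto

lemma ideal_generated_mult_generator:
  assumes "q \<in> poly_ring V" "f \<in> F"
  shows "q * f \<in> ideal_generated V F"
  unfolding ideal_generated_def
  by (rule CollectI, rule exI[of _ "{f}"], rule exI[of _ "\<lambda>_. q"]) (use assms in auto)

lemma ideal_generated_mult: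
  assumes "p \<in> poly_ring V" "f \<in> ideal_generated V F"
  shows "p * f \<in> ideal_generated V F"
proof -
  obtain A q where "finite A" "A \<subseteq> F" "\<forall>f\<in>A. q f \<in> poly_ring V" "f = (\<Sum>f\<in>A. q f * f)"
    using assms(2) by (auto simp: ideal_generated_def)
  then have "finite A \<and> A \<subseteq> F \<and> (\<forall>f\<in>A. p * q f \<in> poly_ring V)"
    and "p * f = (\<Sum>f\<in>A. (p * q f) * f)"
    using assms(1) by (auto simp: sum_distrib_left mult.assoc intro: poly_ring_mult)
  then show ?thesis
    unfolding ideal_generated_def
    by (intro CollectI exI[of _ A] exI[of _ "\<lambda>f. p * q f"]) auto
qed

lemma ideal_generated_add:
  assumes "f \<in> ideal_generated V F" "g \<in> ideal_generated V F"
  shows "f + g \<in> ideal_generated V F"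
proof -
  obtain A q where A: "finite A" "A \<subseteq> F" "\<forall>f\<in>A. q f \<in> poly_ring V" "f = (\<Sum>f\<in>A. q f * f)"
    using assms(1) by (auto simp: ideal_generated_def)
  obtain B r where B: "finite B" "B \<subseteq> F" "\<forall>f\<in>B. r f \<in> poly_ring V" "g = (\<Sum>f\<in>B. r f * f)"
    using assms(2) by (auto simp: ideal_generated_def)
  \<comment> \<open>An element of the ideal has one coefficient per generator, so both coefficient
    families are extended by zero to \<open>A \<union> B\<close> and added.\<close>
  define s where "s h = (if h \<in> A then q h else 0) + (if h \<in> B then r h else 0)" for h
  have "f = (\<Sum>h\<in>A \<union> B. (if h \<in> A then q h else 0) * h)"
    unfolding A(4) by (rule sum.mono_neutral_cong_left) (use A(1-3) B(1-3) in auto)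
  moreover have "g = (\<Sum>h\<in>A \<union> B. (if h \<in> B then r h else 0) * h)"
    unfolding B(4) by (rule sum.mono_neutral_cong_left) (use A(1-3) B(1-3) in auto)
  ultimately have "f + g = (\<Sum>h\<in>A \<union> B. s h * h)"
    by (simp only: s_def distrib_right sum.distrib)
  moreover have "\<forall>h\<in>A \<union> B. s h \<in> poly_ring V"
    unfolding s_def using A B by (auto intro: poly_ring_add)
  ultimately show ?thesis
    unfolding ideal_generated_def using A B
    by (intro CollectI exI[of _ "A \<union> B"] exI[of _ s]) auto
qed

lemma ideal_generated_sum:
  "(\<And>i. i \<in> A \<Longrightarrow> p i \<in> ideal_generated V F) \<Longrightarrow> sum p A \<in> ideal_generated V F"
  by (induction A rule: infinite_finite_induct)
    (auto intro: ideal_generated_add ideal_generated_zero)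

lemma ideal_generated_diff:
  assumes "f \<in> ideal_generated V F" "g \<in> ideal_generated V F"
  shows "f - g \<in> ideal_generated V F"
  using ideal_generated_add[OF assms(1) ideal_generated_mult[OF _ assms(2), of "- 1"]] by simp

lemma ideal_generated_generator: "f \<in> F \<Longrightarrow> f \<in> ideal_generated V F"
  using ideal_generated_mult_generator[of 1 V f F] by simp

lemma ideal_generated_minimal:
  assumes "F \<subseteq> ideal_generated V F'"
  shows "ideal_generated V F \<subseteq> ideal_generated V F'"
  using assms
  by (auto simp: ideal_generated_def[of V F] intro!: ideal_generated_sum ideal_generated_mult)

section \<open>Membership in monomial ideals\<close>

lemma lead_mono_divides_if_in_initial_ideal:
  assumes "(monomial m :: 'k::field mpoly) \<in> initial_ideal lt V G"
  shows "\<exists>g\<in>G. g \<noteq> 0 \<and> mono_divides (lead_mono lt g) m"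
proof -
  obtain A :: "'k mpoly set" and q
    where A: "A \<subseteq> {monomial (lead_mono lt f) | f. f \<in> G \<and> f \<noteq> 0}"
      and m: "monomial m = (\<Sum>f\<in>A. q f * f)"
    using assms unfolding initial_ideal_def ideal_generated_def by blast
  have "m \<in> Poly_Mapping.keys (monomial m :: 'k mpoly)"
    by (simp add: monomial_def)
  \<comment> \<open>The monomial \<open>m\<close> must occur in one of the summands. Each
    \<open>f\<close> is itself a monomial, so all keys of \<open>q f * f\<close> are multiples of
    it.\<close>
  then obtain f where f: "f \<in> A" "m \<in> Poly_Mapping.keys (q f * f)"
    using m keys_sum[of "\<lambda>f. q f * f" A] by auto
  then obtain g where g: "g \<in> G" "g \<noteq> 0" "f = monomial (lead_mono lt g)"
    using A by blast
  obtain u where "m = u + lead_mono lt g"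
    using f(2) keys_mult[of "q f" f] by (auto simp: g(3) monomial_def)
  then show ?thesis
    using g by (auto simp: mono_divides_def lookup_add)
qed

lemma monomial_in_ideal_if_divides:
  assumes "mono_divides u m" "Poly_Mapping.keys m \<subseteq> V" "monomial u \<in> F"
  shows "(monomial m :: 'k::field mpoly) \<in> ideal_generated V F"
proof -
  \<comment> \<open>Subtraction of exponents is truncated; divisibility makes it exact here.\<close>
  have m: "m = (m - u) + u"
    using assms(1)
    by (intro poly_mapping_eqI)
      (simp add: mono_divides_def lookup_add lookup_minus del: split_paired_All)
  have "Poly_Mapping.keys (m - u) \<subseteq> V"
    using assms(2) by (auto simp: in_keys_iff lookup_minus subset_iff)
  then show ?thesis
    by (subst m, unfold monomial_mult) (intro ideal_generated_mult_generator assms(3), simp)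
qed

lemma mono_divides_trans: "mono_divides u v \<Longrightarrow> mono_divides v w \<Longrightarrow> mono_divides u w"
  unfolding mono_divides_def by (meson order_trans)

lemma mono_divides_antisym: "mono_divides u v \<Longrightarrow> mono_divides v u \<Longrightarrow> u = v"
  by (auto simp: mono_divides_def intro!: poly_mapping_eqI antisym)

section \<open>Leading monomials and uniqueness of reduced Groebner bases\<close>

locale variable_order =
  fixes gt :: "point \<Rightarrow> point \<Rightarrow> bool"
  assumes irrefl: "\<not> gt a a"
    and trans: "gt a b \<Longrightarrow> gt b c \<Longrightarrow> gt a c"
    and total: "a \<noteq> b \<Longrightarrow> gt a b \<or> gt b a"
begin

abbreviation less (infix "\<prec>" 50) where "u \<prec> v \<equiv> lex_less gt u v"

lemma less_irrefl: "\<not> u \<prec> u"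
  by (auto simp: lex_less_def)

text \<open>The greater of the two variables that witness the hypotheses witnesses the
  conclusion.\<close>

lemma less_trans:
  assumes "u \<prec> v" "v \<prec> w"
  shows "u \<prec> w"
proof -
  obtain a where a: "Poly_Mapping.lookup u a < Poly_Mapping.lookup v a"
      "\<And>b. gt b a \<Longrightarrow> Poly_Mapping.lookup u b = Poly_Mapping.lookup v b"
    using assms(1) by (auto simp: lex_less_def)
  obtain b where b: "Poly_Mapping.lookup v b < Poly_Mapping.lookup w b"
      "\<And>c. gt c b \<Longrightarrow> Poly_Mapping.lookup v c = Poly_Mapping.lookup w c"
    using assms(2) by (auto simp: lex_less_def)
  consider "a = b" | "gt a b" | "gt b a"
    using total by blast
  then show ?thesis
  proof cases
    case 1
    have "Poly_Mapping.lookup u a < Poly_Mapping.lookup w a"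
      using a(1) b(1) 1 by simp
    moreover have "Poly_Mapping.lookup u c = Poly_Mapping.lookup w c" if "gt c a" for c
      using a(2)[OF that] b(2)[of c] that 1 by simp
    ultimately show ?thesis
      unfolding lex_less_def by blast
  next
    case 2
    have "Poly_Mapping.lookup u a < Poly_Mapping.lookup w a"
      using a(1) b(2)[OF 2] by simp
    moreover have "Poly_Mapping.lookup u c = Poly_Mapping.lookup w c" if "gt c a" for c
      using a(2)[OF that] b(2)[OF trans[OF that 2]] by simp
    ultimately show ?thesis
      unfolding lex_less_def by blast
  next
    case 3
    have "Poly_Mapping.lookup u b < Poly_Mapping.lookup w b"
      using b(1) a(2)[OF 3] by simp
    moreover have "Poly_Mapping.lookup u c = Poly_Mapping.lookup w c" if "gt c b" for c
      using b(2)[OF that] a(2)[OF trans[OF that 3]] by simp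
    ultimately show ?thesis
      unfolding lex_less_def by blast
  qed
qed

lemma less_total:
  assumes "u \<noteq> v"
  shows "u \<prec> v \<or> v \<prec> u"
proof -
  define D where "D = {a. Poly_Mapping.lookup u a \<noteq> Poly_Mapping.lookup v a}"
  have "D \<subseteq> Poly_Mapping.keys u \<union> Poly_Mapping.keys v"
    by (auto simp: D_def in_keys_iff)
  then have "finite D"
    using finite_keys finite_subset by blast
  moreover have "D \<noteq> {}"
    using assms by (auto simp: D_def intro!: poly_mapping_eqI)
  moreover have "asymp_on D (\<lambda>a b. gt b a)"
    by (rule asymp_onI) (use irrefl trans in blast)
  moreover have "transp_on D (\<lambda>a b. gt b a)"
    by (rule transp_onI) (use trans in blast)
  \<comment> \<open>The relation is reversed, so a maximal element for it is the greatest variable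
    at which \<open>u\<close> and \<open>v\<close> differ.\<close>
  ultimately obtain a where "a \<in> D" "\<forall>b\<in>D. b \<noteq> a \<longrightarrow> \<not> gt b a"
    using Finite_Set.bex_max_element[of D "\<lambda>a b. gt b a"] by blast
  then have ne: "Poly_Mapping.lookup u a \<noteq> Poly_Mapping.lookup v a"
    and max: "\<And>b. b \<in> D \<Longrightarrow> b \<noteq> a \<Longrightarrow> \<not> gt b a"
    by (auto simp only: D_def mem_Collect_eq)
  have eq: "Poly_Mapping.lookup u b = Poly_Mapping.lookup v b" if "gt b a" for b
  proof -
    have "b \<noteq> a"
      using that irrefl by metis
    then show ?thesis
      using max[of b] that unfolding D_def by blast
  qed
  show ?thesis
  proof (cases "Poly_Mapping.lookup u a < Poly_Mapping.lookup v a")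
    case True
    then have "u \<prec> v"
      unfolding lex_less_def by (intro exI[of _ a] conjI allI impI eq)
    then show ?thesis ..
  next
    case False
    with ne have "Poly_Mapping.lookup v a < Poly_Mapping.lookup u a"
      by linarith
    then have "v \<prec> u"
      unfolding lex_less_def by (intro exI[of _ a] conjI allI impI eq[symmetric])
    then show ?thesis ..
  qed
qed

text \<open>At the variable that witnesses \<open>u \<prec> v\<close> the exponent of
  \<open>v\<close> exceeds that of \<open>u\<close>.\<close>

lemma not_less_if_divides: "mono_divides v u \<Longrightarrow> \<not> u \<prec> v"
  by (auto simp: mono_divides_def lex_less_def not_less)

lemma lead_mono_eqI:
  assumes "m \<in> Poly_Mapping.keys p" "\<And>m'. m' \<in> Poly_Mapping.keys p \<Longrightarrow> m' \<noteq> m \<Longrightarrow> m' \<prec> m"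
  shows "lead_mono (lex_less gt) p = m"
  unfolding lead_mono_def
proof (rule the_equality)
  show "m \<in> Poly_Mapping.keys p \<and> (\<forall>m'\<in>Poly_Mapping.keys p. m' \<noteq> m \<longrightarrow> m' \<prec> m)"
    using assms by blast
next
  fix n assume n: "n \<in> Poly_Mapping.keys p \<and> (\<forall>m'\<in>Poly_Mapping.keys p. m' \<noteq> n \<longrightarrow> m' \<prec> n)"
  show "n = m"
  proof (rule ccontr)
    assume "n \<noteq> m"
    then have "n \<prec> m" "m \<prec> n"
      using n assms by auto
    then show False
      using less_trans less_irrefl by blast
  qed
qed

lemma lead_mono_props:
  assumes "p \<noteq> 0"
  shows lead_mono_in_keys: "lead_mono (lex_less gt) p \<in> Poly_Mapping.keys p"
    and less_lead_mono: "\<And>m. m \<in> Poly_Mapping.keys p \<Longrightarrow> m \<noteq> lead_mono (lex_less gt) p \<Longrightarrow>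
      m \<prec> lead_mono (lex_less gt) p"
proof -
  have "asymp_on (Poly_Mapping.keys p) (lex_less gt)"
    by (rule asymp_onI) (use less_irrefl less_trans in blast)
  moreover have "transp_on (Poly_Mapping.keys p) (lex_less gt)"
    by (rule transp_onI) (use less_trans in blast)
  ultimately obtain m where m: "m \<in> Poly_Mapping.keys p" "\<forall>m'\<in>Poly_Mapping.keys p. m' \<noteq> m \<longrightarrow> \<not> m \<prec> m'"
    using Finite_Set.bex_max_element[of "Poly_Mapping.keys p" "lex_less gt"] assms by auto
  then have lt: "\<And>m'. m' \<in> Poly_Mapping.keys p \<Longrightarrow> m' \<noteq> m \<Longrightarrow> m' \<prec> m"
    using less_total by blast
  have eq: "lead_mono (lex_less gt) p = m"
    using m(1) lt by (rule lead_mono_eqI)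
  show "lead_mono (lex_less gt) p \<in> Poly_Mapping.keys p"
    unfolding eq by (rule m(1))
  show "u \<prec> lead_mono (lex_less gt) p"
    if "u \<in> Poly_Mapping.keys p" "u \<noteq> lead_mono (lex_less gt) p" for u
    using that unfolding eq by (rule lt)
qed

section \<open>Uniqueness of reduced Groebner bases\<close>

lemma groebner_basis_lead_mono_divides:
  assumes "groebner_basis (lex_less gt) V I G" "f \<in> I" "f \<noteq> 0"
  shows "\<exists>g\<in>G. mono_divides (lead_mono (lex_less gt) g) (lead_mono (lex_less gt) f)"
proof -
  have "monomial (lead_mono (lex_less gt) f) \<in> initial_ideal (lex_less gt) V I"
    unfolding initial_ideal_def by (rule ideal_generated_generator) (use assms in auto)
  then have "monomial (lead_mono (lex_less gt) f) \<in> initial_ideal (lex_less gt) V G"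
    using assms(1) by (simp add: groebner_basis_def)
  then show ?thesis
    using lead_mono_divides_if_in_initial_ideal by blast
qed

text \<open>Some \<open>x\<close> in \<open>G\<close> has a leading monomial dividing that of
  \<open>f\<close>, which is a monomial of \<open>g\<close>; reducedness forces
  \<open>x = g\<close>. In the tail of \<open>g\<close>, that monomial would be smaller than one of
  its divisors.\<close>

lemma reduced_groebner_basis_lead_mono_not_in_tail:
  assumes "reduced_groebner_basis (lex_less gt) V I G" "g \<in> G" "f \<in> I" "f \<noteq> 0"
    and "lead_mono (lex_less gt) f \<in> Poly_Mapping.keys g"
  shows "lead_mono (lex_less gt) f = lead_mono (lex_less gt) g"
proof (rule ccontr)
  assume ne: "lead_mono (lex_less gt) f \<noteq> lead_mono (lex_less gt) g"
  have "groebner_basis (lex_less gt) V I G"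
    using assms(1) by (simp add: reduced_groebner_basis_def)
  then obtain x where
    x: "x \<in> G" "mono_divides (lead_mono (lex_less gt) x) (lead_mono (lex_less gt) f)"
    using groebner_basis_lead_mono_divides assms(3,4) by blast
  have "x = g"
    using assms(1,2,5) x by (auto simp: reduced_groebner_basis_def)
  have "g \<noteq> 0"
    using assms(5) by auto
  then have "lead_mono (lex_less gt) f \<prec> lead_mono (lex_less gt) g"
    using assms(5) ne by (rule less_lead_mono)
  then show False
    using not_less_if_divides[OF x(2)] unfolding \<open>x = g\<close> by contradiction
qed

text \<open>Dividing back and forth between \<open>G\<close> and \<open>H\<close> pairs each
  \<open>g\<close> with an \<open>h\<close> of the same leading monomial. The leading terms cancel
  in \<open>g - h\<close>, so a nonzero difference would have its leading monomial in the tail of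
  \<open>g\<close> or of \<open>h\<close>.\<close>

lemma reduced_groebner_basis_subset:
  assumes G: "reduced_groebner_basis (lex_less gt) V I G"
    and H: "reduced_groebner_basis (lex_less gt) V I H"
    and diff: "\<And>f g. f \<in> I \<Longrightarrow> g \<in> I \<Longrightarrow> f - g \<in> I"
  shows "G \<subseteq> H"
proof
  fix g assume g: "g \<in> G"
  let ?lm = "lead_mono (lex_less gt)"
  have gG: "groebner_basis (lex_less gt) V I G" and gH: "groebner_basis (lex_less gt) V I H"
    using G H by (auto simp: reduced_groebner_basis_def)
  then have sub: "G \<subseteq> I" "H \<subseteq> I" "0 \<notin> G" "0 \<notin> H"
    by (auto simp: groebner_basis_def)
  obtain h where h: "h \<in> H" "mono_divides (?lm h) (?lm g)"
    using groebner_basis_lead_mono_divides[OF gH, of g] g sub by blast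
  \<comment> \<open>The leading monomial of \<open>g'\<close> divides that of \<open>h\<close> and
    hence that of \<open>g\<close>; as \<open>G\<close> is reduced, \<open>g'\<close> can only be
    \<open>g\<close>.\<close>
  obtain g' where g': "g' \<in> G" "mono_divides (?lm g') (?lm h)"
    using groebner_basis_lead_mono_divides[OF gG, of h] h sub by blast
  have "?lm g \<in> Poly_Mapping.keys g"
    using g sub by (metis lead_mono_in_keys)
  then have "g' = g"
    using G g g'(1) mono_divides_trans[OF g'(2) h(2)] by (auto simp: reduced_groebner_basis_def)
  then have eq: "?lm g = ?lm h"
    using g' h mono_divides_antisym by blast
  have "g - h = 0"
  proof (rule ccontr)
    assume nz: "g - h \<noteq> 0"
    have in_I: "g - h \<in> I"
      using diff sub g h by blast
    have keys: "?lm (g - h) \<in> Poly_Mapping.keys (g - h)"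
      using lead_mono_in_keys nz by blast
    have "Poly_Mapping.lookup g (?lm g) = 1" "Poly_Mapping.lookup h (?lm h) = 1"
      using G H g h by (auto simp: reduced_groebner_basis_def leading_coeff_def)
    then have "Poly_Mapping.lookup (g - h) (?lm g) = 0"
      using eq by (simp add: lookup_minus)
    then have "?lm (g - h) \<noteq> ?lm g"
      using keys by (auto simp: in_keys_iff)
    then show False
      using keys keys_diff[of g h] eq nz in_I
        reduced_groebner_basis_lead_mono_not_in_tail[OF G g in_I nz]
        reduced_groebner_basis_lead_mono_not_in_tail[OF H h(1) in_I nz]
      by auto
  qed
  with h show "g \<in> H" by simp
qed

end

section \<open>Row and column sums\<close>

text \<open>Here \<open>\<delta>\<close> plays the role of a grading of the monomials. As a function
  of \<open>f\<close> this is additive, which allows it to be checked on single terms.\<close>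

definition fibre_sum :: "('m \<Rightarrow> 'd) \<Rightarrow> 'd \<Rightarrow> ('m \<Rightarrow>\<^sub>0 'k::ab_group_add) \<Rightarrow> 'k" where
  "fibre_sum \<delta> d f = (\<Sum>m\<in>{m \<in> Poly_Mapping.keys f. \<delta> m = d}. Poly_Mapping.lookup f m)"

lemma fibre_sum_superset:
  assumes "finite S" "Poly_Mapping.keys f \<subseteq> S"
  shows "fibre_sum \<delta> d f = (\<Sum>m\<in>{m \<in> S. \<delta> m = d}. Poly_Mapping.lookup f m)"
  unfolding fibre_sum_def
  by (rule sum.mono_neutral_left) (use assms in \<open>auto simp: in_keys_iff\<close>)

lemma fibre_sum_zero: "fibre_sum \<delta> d 0 = 0"
  by (simp add: fibre_sum_def)

lemma fibre_sum_single:
  "fibre_sum \<delta> d (Poly_Mapping.single m c) = (if \<delta> m = d then c else 0)"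
proof -
  have "{m' \<in> {m}. \<delta> m' = d} = (if \<delta> m = d then {m} else {})"
    by auto
  then show ?thesis
    by (subst fibre_sum_superset[of "{m}"]) auto
qed

lemma fibre_sum_add: "fibre_sum \<delta> d (f + g) = fibre_sum \<delta> d f + fibre_sum \<delta> d g"
proof -
  have S: "finite (Poly_Mapping.keys f \<union> Poly_Mapping.keys g)"
    by simp
  show ?thesis
    using keys_add[of f g]
    by (simp add: fibre_sum_superset[OF S] lookup_add sum.distrib)
qed

lemma fibre_sum_diff: "fibre_sum \<delta> d (f - g) = fibre_sum \<delta> d f - fibre_sum \<delta> d g"
  using fibre_sum_add[of \<delta> d "f - g" g] by simp

lemma fibre_sum_sum: "fibre_sum \<delta> d (sum p A) = (\<Sum>i\<in>A. fibre_sum \<delta> d (p i))"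
  by (induction A rule: infinite_finite_induct) (auto simp: fibre_sum_add fibre_sum_zero)

text \<open>By additivity \<open>q\<close> may be a single term. The product is then a difference of
  two terms with equal coefficients and equal \<open>\<delta>\<close>.\<close>

lemma fibre_sum_mult_binomial:
  fixes q :: "'k::field mpoly"
  assumes "\<And>u. \<delta> (u + v) = \<delta> (u + w)"
  shows "fibre_sum \<delta> d (q * (monomial v - monomial w)) = 0"
proof -
  have "fibre_sum \<delta> d (Poly_Mapping.single u c * (monomial v - monomial w)) = 0" for u and c :: 'k
    by (simp add: right_diff_distrib monomial_def mult_single fibre_sum_diff fibre_sum_single assms)
  then show ?thesis
    by (subst sum_singles[of q]) (simp only: sum_distrib_right fibre_sum_sum sum.neutral_const)
qed

lemma ideal_generated_fibre_sum:
  assumes "f \<in> ideal_generated V F" "\<And>q g. g \<in> F \<Longrightarrow> fibre_sum \<delta> d (q * g) = 0"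
  shows "fibre_sum \<delta> d f = 0"
  using assms by (auto simp: ideal_generated_def fibre_sum_sum subset_iff intro!: sum.neutral)

text \<open>For a monomial in the variables of the box this is the exponent vector of its image
  under the toric map sending the variable of \<open>(c, j)\<close> to \<open>s_c * t_j\<close>. The
  bound \<open>N\<close> keeps the sums finite; it is later chosen above all coordinates of
  vertices.\<close>

definition box_sums :: "nat \<Rightarrow> mono \<Rightarrow> (nat \<Rightarrow> nat) \<times> (nat \<Rightarrow> nat)" where
  "box_sums N m = ((\<lambda>c. \<Sum>j<N. Poly_Mapping.lookup m (c, j)),
                   (\<lambda>j. \<Sum>c<N. Poly_Mapping.lookup m (c, j)))"

text \<open>Diagonal and anti-diagonal corners meet the same two columns and the same two rows, once
  each.\<close>

lemma box_sums_corner_swap: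
  assumes "i < N" "k < N" "j < N" "l < N"
  shows "box_sums N (u + (Poly_Mapping.single (i, j) 1 + Poly_Mapping.single (k, l) 1)) =
    box_sums N (u + (Poly_Mapping.single (k, j) 1 + Poly_Mapping.single (i, l) 1))"
proof -
  have col: "(\<Sum>y<N. Poly_Mapping.lookup (Poly_Mapping.single (a, b) 1) (x, y)) =
      (if x = a then 1 else 0 :: nat)" if "b < N" for a b x :: nat
    using that by (simp add: lookup_single when_def cong: if_cong)
  have row: "(\<Sum>x<N. Poly_Mapping.lookup (Poly_Mapping.single (a, b) 1) (x, y)) =
      (if y = b then 1 else 0 :: nat)" if "a < N" for a b y :: nat
    using that by (simp add: lookup_single when_def cong: if_cong)
  show ?thesis
    using assms by (simp add: box_sums_def lookup_add sum.distrib col row add_ac del: One_nat_def)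
qed

section \<open>Stack polyominoes\<close>

lemma mem_vertices_iff:
  "(c, l) \<in> vertices P \<longleftrightarrow> (\<exists>r s. (r, s) \<in> P \<and> (c = r \<or> c = r + 1) \<and> (l = s \<or> l = s + 1))"
proof -
  have "(c, l) \<in> cell_vertices (r, s) \<longleftrightarrow> (c = r \<or> c = r + 1) \<and> (l = s \<or> l = s + 1)" for r s
    by (auto simp: cell_vertices_def)
  then show ?thesis
    by (simp add: vertices_def Bex_def split_paired_Ex)
qed

lemma cell_corners_in_vertices:
  assumes "(r, s) \<in> P"
  shows "(r, s) \<in> vertices P" "(r + 1, s) \<in> vertices P"
    "(r, s + 1) \<in> vertices P" "(r + 1, s + 1) \<in> vertices P"
  unfolding mem_vertices_iff using assms by blast+

lemma finite_vertices: "finite P \<Longrightarrow> finite (vertices P)"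
  by (auto simp: vertices_def cell_vertices_def split: prod.splits)

lemma inner_interval_corners:
  assumes "inner_interval P (i, j) (k, l)"
  shows "(i, j) \<in> vertices P" "(k, l) \<in> vertices P" "(k, j) \<in> vertices P" "(i, l) \<in> vertices P"
proof -
  have "i < k" "j < l"
    and *: "\<And>r s. i \<le> r \<Longrightarrow> r + 1 \<le> k \<Longrightarrow> j \<le> s \<Longrightarrow> s + 1 \<le> l \<Longrightarrow> (r, s) \<in> P"
    using assms by (auto simp: inner_interval_def proper_interval_def interval_cells_def)
  then have "(i, j) \<in> P" "(k - 1, l - 1) \<in> P" "(k - 1, j) \<in> P" "(i, l - 1) \<in> P"
    by (auto intro!: *)
  from this[THEN cell_corners_in_vertices(1)] this[THEN cell_corners_in_vertices(2)]
    this[THEN cell_corners_in_vertices(3)] this[THEN cell_corners_in_vertices(4)]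
  show "(i, j) \<in> vertices P" "(k, l) \<in> vertices P" "(k, j) \<in> vertices P" "(i, l) \<in> vertices P"
    using \<open>i < k\<close> \<open>j < l\<close> by simp_all
qed

text \<open>The bargraph shape of a stack polyomino, freed from the enumeration of its
  columns.\<close>

definition flat_bottom :: "cell set \<Rightarrow> nat \<Rightarrow> bool" where
  "flat_bottom P j0 \<longleftrightarrow>
    (\<forall>(c, s)\<in>P. j0 \<le> s \<and> (\<forall>s'. j0 \<le> s' \<and> s' \<le> s \<longrightarrow> (c, s') \<in> P))"

lemma flat_bottomD:
  assumes "flat_bottom P j0" "(c, s) \<in> P"
  shows flat_bottom_ge: "j0 \<le> s"
    and flat_bottom_downward: "\<And>s'. j0 \<le> s' \<Longrightarrow> s' \<le> s \<Longrightarrow> (c, s') \<in> P"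
  using assms unfolding flat_bottom_def by blast+

lemma stack_polyomino_flat_bottom:
  assumes "stack_polyomino P"
  obtains j0 where "flat_bottom P j0"
proof -
  obtain r i0 j0 t where P: "P = (\<Union>i\<in>{1..r}. vertical_cell_interval (i0 + (i - 1)) j0 (t i))"
    using assms by (auto simp: stack_polyomino_def)
  have "flat_bottom P j0"
    unfolding P flat_bottom_def vertical_cell_interval_def by auto
  then show thesis ..
qed

lemma flat_bottom_vertex_ge: "flat_bottom P j0 \<Longrightarrow> (c, l) \<in> vertices P \<Longrightarrow> j0 \<le> l"
  unfolding mem_vertices_iff by (auto dest: flat_bottom_ge)

text \<open>If the vertex is on the bottom edge of a cell, \<open>j0 < l\<close> ensures that the
  next cell down is in \<open>P\<close> too, and the vertex is on the top edge of that one.\<close>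

lemma flat_bottom_vertex_cell:
  assumes "flat_bottom P j0" "(c, l) \<in> vertices P" "j0 < l"
  shows "\<exists>r. (r, l - 1) \<in> P \<and> (c = r \<or> c = r + 1)"
proof -
  obtain r s where rs: "(r, s) \<in> P" "c = r \<or> c = r + 1" "l = s \<or> l = s + 1"
    using assms(2) by (auto simp: mem_vertices_iff)
  then have "j0 \<le> l - 1" "l - 1 \<le> s"
    using assms(3) by auto
  then show ?thesis
    using rs flat_bottom_downward[OF assms(1) rs(1)] by blast
qed

text \<open>Take a cell with \<open>(c, l')\<close> as a corner. Either the cell of its column at
  height \<open>l\<close> is in \<open>P\<close>, or row \<open>l\<close> is its top edge.\<close>

lemma flat_bottom_vertices_downward:
  assumes "flat_bottom P j0" "(c, l') \<in> vertices P" "j0 \<le> l" "l \<le> l'"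
  shows "(c, l) \<in> vertices P"
proof -
  obtain r s where rs: "(r, s) \<in> P" "c = r \<or> c = r + 1" "l' = s \<or> l' = s + 1"
    using assms(2) by (auto simp: mem_vertices_iff)
  show ?thesis
  proof (cases "l \<le> s")
    case True
    then have "(r, l) \<in> P"
      using flat_bottom_downward[OF assms(1) rs(1) assms(3)] by blast
    then show ?thesis
      using rs(2) unfolding mem_vertices_iff by blast
  next
    case False
    then have "l = s + 1"
      using rs(3) assms(4) by linarith
    then show ?thesis
      using rs(1,2) unfolding mem_vertices_iff by blast
  qed
qed

text \<open>The top edge determines everything: both its ends border cells of row
  \<open>l - 1\<close>, row convexity fills that row between them, and each of these cells brings
  along all cells below it down to \<open>j0\<close>.\<close>

lemma flat_bottom_inner_interval:
  assumes "row_convex P" "flat_bottom P j0"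
    and "(i, l) \<in> vertices P" "(k, l) \<in> vertices P" "i < k" "j0 \<le> j" "j < l"
  shows "inner_interval P (i, j) (k, l)"
proof -
  have "j0 < l" using assms by simp
  then obtain r where r: "(r, l - 1) \<in> P" "r \<le> i"
    using flat_bottom_vertex_cell[OF assms(2,3)] by auto
  obtain r' where r': "(r', l - 1) \<in> P" "k \<le> r' + 1"
    using flat_bottom_vertex_cell[OF assms(2,4) \<open>j0 < l\<close>] by auto
  have "(x, y) \<in> P" if "i \<le> x" "x + 1 \<le> k" "j \<le> y" "y + 1 \<le> l" for x y
  proof -
    have "r \<le> x" "x \<le> r'" "r \<le> r'"
      using r(2) r'(2) that by linarith+
    then have cell: "(x, l - 1) \<in> P"
      using assms(1) r(1) r'(1) unfolding row_convex_def by blast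
    show ?thesis
      by (rule flat_bottom_downward[OF assms(2) cell]) (use assms(6) that in linarith)+
  qed
  then show ?thesis
    using assms(5,7) by (auto simp: inner_interval_def proper_interval_def interval_cells_def)
qed

lemma finite_inner_intervals: "finite P \<Longrightarrow> finite {(a, b). inner_interval P a b}"
  by (rule finite_subset[of _ "vertices P \<times> vertices P"])
    (auto simp: finite_vertices dest: inner_interval_corners)

section \<open>Column orders\<close>

text \<open>The two variable orders differ only in the direction in which the columns are compared:
  \<open>R x y\<close> means that the variables of column \<open>x\<close> are greater than those of column \<open>y\<close>.\<close>

definition column_gt :: "(nat \<Rightarrow> nat \<Rightarrow> bool) \<Rightarrow> point \<Rightarrow> point \<Rightarrow> bool" where
  "column_gt R a b \<longleftrightarrow> R (fst a) (fst b) \<or> (fst a = fst b \<and> snd a > snd b)"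

locale column_order =
  fixes R :: "nat \<Rightarrow> nat \<Rightarrow> bool"
  assumes R_irrefl: "\<not> R x x"
    and R_trans: "R x y \<Longrightarrow> R y z \<Longrightarrow> R x z"
    and R_total: "x \<noteq> y \<Longrightarrow> R x y \<or> R y x"

sublocale column_order \<subseteq> variable_order "column_gt R"
proof
  fix a b c :: point
  show "\<not> column_gt R a a"
    by (simp add: column_gt_def R_irrefl)
  show "column_gt R a b \<Longrightarrow> column_gt R b c \<Longrightarrow> column_gt R a c"
    using R_trans[of "fst a" "fst b" "fst c"] by (auto simp: column_gt_def)
  show "a \<noteq> b \<Longrightarrow> column_gt R a b \<or> column_gt R b a"
    using R_total[of "fst a" "fst b"]
    by (cases "fst a = fst b") (auto simp: column_gt_def prod_eq_iff)
qed

section \<open>Minors with signs chosen by the column order\<close>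

context column_order
begin

text \<open>The product of the variables of \<open>(i, j)\<close> and \<open>(k, l)\<close>, meant
  for \<open>R k i\<close> and \<open>j < l\<close>. Exchanging \<open>i\<close> and
  \<open>k\<close> gives the other term of the minor.\<close>

abbreviation lead :: "nat \<Rightarrow> nat \<Rightarrow> nat \<Rightarrow> nat \<Rightarrow> mono" where
  "lead k l i j \<equiv> Poly_Mapping.single (i, j) 1 + Poly_Mapping.single (k, l) 1"

notation less (infix "\<prec>" 50)

definition column_minor :: "nat \<Rightarrow> nat \<Rightarrow> nat \<Rightarrow> nat \<Rightarrow> 'k::field mpoly" where
  "column_minor k l i j = monomial (lead k l i j) - monomial (lead i l k j)"

text \<open>\<open>R k i\<close> does not say which of the two columns lies to the left, hence
  \<open>min\<close> and \<open>max\<close>.\<close>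

definition column_inner :: "cell set \<Rightarrow> nat \<Rightarrow> nat \<Rightarrow> nat \<Rightarrow> nat \<Rightarrow> bool" where
  "column_inner P k l i j \<longleftrightarrow> R k i \<and> inner_interval P (min i k, j) (max i k, l)"

definition column_minors :: "cell set \<Rightarrow> 'k::field mpoly set" where
  "column_minors P = {column_minor k l i j | k l i j. column_inner P k l i j}"

lemma R_distinct: "R x y \<Longrightarrow> x \<noteq> y"
  using R_irrefl by metis

lemma R_asym: "R x y \<Longrightarrow> \<not> R y x"
  using R_irrefl R_trans by metis

lemma column_inner_distinct: "column_inner P k l i j \<Longrightarrow> R k i \<and> k \<noteq> i \<and> j < l"
  by (simp add: R_distinct column_inner_def inner_interval_def proper_interval_def)

lemma lead_neq:
  assumes "k \<noteq> i" "j < l"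
  shows "lead k l i j \<noteq> lead i l k j"
proof
  assume "lead k l i j = lead i l k j"
  then have "Poly_Mapping.lookup (lead k l i j) (i, j) = Poly_Mapping.lookup (lead i l k j) (i, j)"
    by simp
  then show False
    using assms by (simp add: lookup_add lookup_single when_def split: if_splits)
qed

text \<open>The greatest of the four corner variables is that of \<open>(k, l)\<close>, and it
  occurs only in \<open>lead k l i j\<close>.\<close>

lemma lead_less:
  assumes "R k i" "j < l"
  shows "lead i l k j \<prec> lead k l i j"
proof -
  have "k \<noteq> i" "\<not> R i k"
    using assms(1) by (rule R_distinct, rule R_asym)
  then have "Poly_Mapping.lookup (lead i l k j) (k, l) < Poly_Mapping.lookup (lead k l i j) (k, l)"
    using assms(2) by (simp add: lookup_add lookup_single when_def)
  moreover have "Poly_Mapping.lookup (lead i l k j) b = Poly_Mapping.lookup (lead k l i j) b"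
    if "column_gt R b (k, l)" for b
  proof -
    have "(k, l) \<noteq> b" "(i, j) \<noteq> b" "(k, j) \<noteq> b" "(i, l) \<noteq> b"
      using that \<open>k \<noteq> i\<close> \<open>\<not> R i k\<close> assms(2) R_irrefl by (auto simp: column_gt_def)
    then show ?thesis
      by (simp add: lookup_add lookup_single_not_eq)
  qed
  ultimately show ?thesis
    unfolding lex_less_def by blast
qed

lemma column_minor_keys:
  assumes "k \<noteq> i" "j < l"
  shows "Poly_Mapping.keys (column_minor k l i j :: 'k::field mpoly) = {lead k l i j, lead i l k j}"
  using lead_neq[OF assms] unfolding column_minor_def monomial_def set_eq_iff
  by (simp add: in_keys_iff lookup_minus lookup_single when_def del: One_nat_def)

lemma lead_mono_column_minor:
  assumes "R k i" "j < l"
  shows "lead_mono (lex_less (column_gt R)) (column_minor k l i j :: 'k::field mpoly) = lead k l i j"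
  using lead_less[OF assms]
  by (intro lead_mono_eqI) (auto simp: column_minor_keys[OF R_distinct[OF assms(1)] assms(2)])

lemma leading_coeff_column_minor:
  assumes "R k i" "j < l"
  shows "leading_coeff (lex_less (column_gt R)) (column_minor k l i j :: 'k::field mpoly) = 1"
  unfolding leading_coeff_def lead_mono_column_minor[OF assms]
  unfolding column_minor_def monomial_def lookup_minus
  using lead_neq[OF R_distinct[OF assms(1)] assms(2)]
  by (simp add: lookup_single_not_eq del: One_nat_def)

text \<open>The sign depends on which of the two columns comes first in \<open>R\<close>.\<close>

lemma inner_minor_column_minor:
  assumes "inner_interval P a b"
  shows "\<exists>g\<in>column_minors P. (minor a b :: 'k::field mpoly) = g \<or> minor a b = - g"
proof -
  obtain i j k l where ab: "a = (i, j)" "b = (k, l)"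
    by fastforce
  have "i < k" "j < l"
    using assms by (auto simp: ab inner_interval_def proper_interval_def)
  have m: "minor a b = column_minor k l i j" "minor a b = - column_minor i l k j"
    by (simp_all add: ab minor_def var_def column_minor_def flip: monomial_mult)
  have "column_inner P k l i j \<or> column_inner P i l k j"
    using R_total[of i k] \<open>i < k\<close> assms by (auto simp: column_inner_def ab)
  then show ?thesis
    using m unfolding column_minors_def by blast
qed

lemma column_minor_inner_minor:
  assumes "(g :: 'k::field mpoly) \<in> column_minors P"
  shows "\<exists>f\<in>inner_minors P. g = f \<or> g = - f"
proof -
  obtain k l i j where g: "g = column_minor k l i j" "column_inner P k l i j"
    using assms by (auto simp: column_minors_def)
  then have I: "inner_interval P (min i k, j) (max i k, l)"
    by (simp add: column_inner_def)
  have "g = minor (min i k, j) (max i k, l) \<or> g = - minor (min i k, j) (max i k, l)"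
    by (simp add: g min_def max_def minor_def var_def column_minor_def flip: monomial_mult)
  moreover have "minor (min i k, j) (max i k, l) \<in> inner_minors P"
    using I unfolding inner_minors_def by blast
  ultimately show ?thesis
    by blast
qed

lemma leading_coeff_column_minors:
  assumes "(g :: 'k::field mpoly) \<in> column_minors P"
  shows "leading_coeff (lex_less (column_gt R)) g = 1"
proof -
  obtain k l i j where g: "g = column_minor k l i j" "column_inner P k l i j"
    using assms by (auto simp: column_minors_def)
  show ?thesis
    unfolding g(1) using column_inner_distinct[OF g(2)] by (intro leading_coeff_column_minor) auto
qed

section \<open>Comparison with the inner minors up to sign\<close>

lemma equal_up_to_sign_column_minors:
  "equal_up_to_sign (column_minors P :: 'k::field mpoly set) (inner_minors P)"
proof -
  \<comment> \<open>The sign must be a function of the polynomial alone, so it is read off from the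
    leading coefficient.\<close>
  define \<sigma> where
    "\<sigma> f = (if leading_coeff (lex_less (column_gt R)) f = 1 then f else - f)" for f :: "'k mpoly"
  have lm: "lead_mono (lex_less (column_gt R)) (- g) = lead_mono (lex_less (column_gt R)) g"
    for g :: "'k mpoly"
    by (simp add: lead_mono_def)
  have \<sigma>: "\<sigma> g = g \<and> \<sigma> (- g) = g" if "g \<in> column_minors P" for g :: "'k mpoly"
  proof -
    \<comment> \<open>In characteristic 2 the polynomial \<open>- g\<close> also has leading
      coefficient 1 and is left unchanged by \<open>\<sigma>\<close>, which is harmless since it
      equals \<open>g\<close>.\<close>
    have "g = - g" if "- 1 = (1 :: 'k)"
    proof (rule poly_mapping_eqI)
      fix m
      show "Poly_Mapping.lookup g m = Poly_Mapping.lookup (- g) m"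
        using arg_cong[OF that, of "\<lambda>x. x * Poly_Mapping.lookup g m"] by simp
    qed
    then show ?thesis
      using leading_coeff_column_minors[OF that] by (auto simp: \<sigma>_def leading_coeff_def lm)
  qed
  have "\<sigma> ` inner_minors P = column_minors P"
  proof safe
    fix f :: "'k mpoly" assume "f \<in> inner_minors P"
    then obtain a b where f: "f = minor a b" "inner_interval P a b"
      unfolding inner_minors_def by blast
    obtain g where "g \<in> column_minors P" "f = g \<or> f = - g"
      unfolding f(1) using inner_minor_column_minor[OF f(2)] by blast
    then show "\<sigma> f \<in> column_minors P"
      using \<sigma> by auto
  next
    fix g :: "'k mpoly" assume g: "g \<in> column_minors P"
    then obtain f where "f \<in> inner_minors P" "g = f \<or> g = - f"
      using column_minor_inner_minor by blast
    then show "g \<in> \<sigma> ` inner_minors P"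
      using \<sigma>[OF g] by (metis image_eqI minus_minus)
  qed
  then show ?thesis
    unfolding equal_up_to_sign_def by (intro exI[of _ \<sigma>]) (auto simp: \<sigma>_def)
qed

lemma equal_up_to_sign_finite: "equal_up_to_sign G M \<Longrightarrow> finite M \<Longrightarrow> finite G"
  by (auto simp: equal_up_to_sign_def)

lemma finite_column_minors:
  assumes "finite P"
  shows "finite (column_minors P :: 'k::field mpoly set)"
proof -
  have "(inner_minors P :: 'k mpoly set) \<subseteq>
      (\<lambda>(a, b). minor a b) ` {(a, b). inner_interval P a b}"
  proof
    fix f :: "'k mpoly" assume "f \<in> inner_minors P"
    then obtain a b where "f = minor a b" "inner_interval P a b"
      unfolding inner_minors_def by blast
    then show "f \<in> (\<lambda>(a, b). minor a b) ` {(a, b). inner_interval P a b}"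
      by (intro image_eqI[of _ _ "(a, b)"]) simp_all
  qed
  then have "finite (inner_minors P :: 'k mpoly set)"
    using finite_inner_intervals[OF assms] by (rule finite_subset[OF _ finite_imageI])
  with equal_up_to_sign_column_minors show ?thesis
    by (rule equal_up_to_sign_finite)
qed

section \<open>Leading monomials of the polyomino ideal\<close>

lemma inner_minors_fibre_sum:
  assumes "vertices P \<subseteq> {..<N} \<times> {..<N}" "f \<in> inner_minors P"
  shows "fibre_sum (box_sums N) d (q * f) = 0"
proof -
  obtain i j k l where f: "f = minor (i, j) (k, l)" "inner_interval P (i, j) (k, l)"
    using assms(2) by (auto simp: inner_minors_def)
  then have "i < N" "j < N" "k < N" "l < N"
    using assms(1) inner_interval_corners[of P i j k l] by auto
  then have "fibre_sum (box_sums N) d (q * (monomial (lead k l i j) - monomial (lead i l k j))) = 0"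
    by (intro fibre_sum_mult_binomial box_sums_corner_swap)
  then show ?thesis
    by (simp add: f minor_def var_def flip: monomial_mult)
qed

lemma fibre_not_minimal:
  assumes conv: "row_convex P" and flat: "flat_bottom P j0"
    and box: "vertices P \<subseteq> {..<N} \<times> {..<N}"
    and m: "Poly_Mapping.keys m \<subseteq> vertices P" and m': "Poly_Mapping.keys m' \<subseteq> vertices P"
    and sums: "box_sums N m' = box_sums N m" and less: "m' \<prec> m"
  shows "\<exists>k l i j. column_inner P k l i j \<and> mono_divides (lead k l i j) m"
proof -
  let ?x = "Poly_Mapping.lookup m" and ?y = "Poly_Mapping.lookup m'"
  have in_V: "(c, j) \<in> vertices P" if "?x (c, j) \<noteq> 0 \<or> ?y (c, j) \<noteq> 0" for c j
    using m m' that by (auto simp: in_keys_iff subset_iff)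
  obtain k l where kl: "?y (k, l) < ?x (k, l)"
    and gt: "\<And>b. column_gt R b (k, l) \<Longrightarrow> ?y b = ?x b"
    using less by (auto simp: lex_less_def)
  have klV: "(k, l) \<in> vertices P"
    using in_V kl by fastforce
  then have "k < N" "l < N"
    using box by auto
  have j0: "j0 \<le> l"
    using flat_bottom_vertex_ge[OF flat klV] .
  have col: "(\<Sum>j<N. ?y (c, j)) = (\<Sum>j<N. ?x (c, j))" for c
    using fun_cong[OF arg_cong[OF sums, of fst], of c] by (simp add: box_sums_def)
  have row: "(\<Sum>c<N. ?y (c, j)) = (\<Sum>c<N. ?x (c, j))" for j
    using fun_cong[OF arg_cong[OF sums, of snd], of j] by (simp add: box_sums_def)
  \<comment> \<open>Such a column \<open>c\<close> supplies the second column of the wanted minor,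
    and \<open>j\<close> its lower row.\<close>
  have "\<exists>c j. (c, l) \<in> vertices P \<and> R k c \<and> j < l \<and> ?x (c, j) \<noteq> 0"
  proof (rule ccontr)
    assume none: "\<not> ?thesis"
    have "(\<Sum>j\<in>{l..<N}. ?y (c, j)) \<le> (\<Sum>j\<in>{l..<N}. ?x (c, j))" for c
    proof -
      \<comment> \<open>In columns before \<open>k\<close> both monomials agree. In column
        \<open>k\<close> they agree above row \<open>l\<close>, and \<open>m'\<close> has the
        smaller exponent at \<open>l\<close>. Later columns either reach row \<open>l\<close>, where
        column sums decide, or have no vertices from row \<open>l\<close> upwards.\<close>
      consider "R c k" | "c = k" | "R k c" "(c, l) \<in> vertices P" | "(c, l) \<notin> vertices P"
        using R_total by blast
      then show ?thesis
      proof cases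
        case 1
        then show ?thesis
          using gt by (simp add: column_gt_def)
      next
        case 2
        have "?y (k, j) \<le> ?x (k, j)" if "l \<le> j" for j
          using gt[of "(k, j)"] kl that by (cases "j = l") (auto simp: column_gt_def)
        then show ?thesis
          by (auto simp: 2 intro!: sum_mono)
      next
        case 3
        have "(\<Sum>j\<in>{l..<N}. ?y (c, j)) \<le> (\<Sum>j<N. ?y (c, j))"
          by (rule sum_mono2) auto
        \<comment> \<open>By \<open>none\<close>, the monomial \<open>m\<close> has no variable of
          this column below row \<open>l\<close>, so its full column sum is already its part from
          row \<open>l\<close> upwards.\<close>
        also have "\<dots> = (\<Sum>j\<in>{l..<N}. ?x (c, j))"
          unfolding col using 3 none by (intro sum.mono_neutral_right) auto
        finally show ?thesis .
      next
        case 4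
        have "?y (c, j) = 0" if "l \<le> j" for j
          using in_V[of c j] 4 flat_bottom_vertices_downward[OF flat _ j0 that] by blast
        then show ?thesis by simp
      qed
    qed
    moreover have "(\<Sum>j\<in>{l..<N}. ?y (k, j)) < (\<Sum>j\<in>{l..<N}. ?x (k, j))"
    proof (rule sum_strict_mono_ex1)
      show "\<forall>j\<in>{l..<N}. ?y (k, j) \<le> ?x (k, j)"
      proof
        fix j assume "j \<in> {l..<N}"
        then show "?y (k, j) \<le> ?x (k, j)"
          using gt[of "(k, j)"] kl by (cases "j = l") (auto simp: column_gt_def)
      qed
    qed (use kl \<open>l < N\<close> in auto)
    ultimately have "(\<Sum>c<N. \<Sum>j\<in>{l..<N}. ?y (c, j)) < (\<Sum>c<N. \<Sum>j\<in>{l..<N}. ?x (c, j))"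
      using \<open>k < N\<close> by (intro sum_strict_mono_ex1) auto
    \<comment> \<open>Summed row by row instead, the two totals agree because all row sums
      do.\<close>
    moreover have "(\<Sum>c<N. \<Sum>j\<in>{l..<N}. ?y (c, j)) = (\<Sum>c<N. \<Sum>j\<in>{l..<N}. ?x (c, j))"
      by (subst (1 2) sum.swap) (simp add: row)
    ultimately show False by simp
  qed
  then obtain i j where ij: "(i, l) \<in> vertices P" "R k i" "j < l" "?x (i, j) \<noteq> 0"
    by blast
  have "j0 \<le> j"
    using flat_bottom_vertex_ge[OF flat] in_V ij(4) by blast
  moreover have "i \<noteq> k"
    using ij R_irrefl by blast
  ultimately have "inner_interval P (min i k, j) (max i k, l)"
    using flat_bottom_inner_interval[OF conv flat ij(1) klV]
      flat_bottom_inner_interval[OF conv flat klV ij(1)] ij(3)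
    by (cases "i < k") (auto simp: min_def max_def)
  \<comment> \<open>The exponent of \<open>m\<close> at \<open>(k, l)\<close> is positive because it
    exceeds that of \<open>m'\<close>.\<close>
  moreover have "mono_divides (lead k l i j) m"
    using ij kl \<open>i \<noteq> k\<close>
    by (auto simp: mono_divides_def lookup_add lookup_single when_def)
  ultimately show ?thesis
    using ij by (auto simp: column_inner_def)
qed

lemma inner_minors_subset_poly_ring:
  "(inner_minors P :: 'k::field mpoly set) \<subseteq> poly_ring (vertices P)"
proof
  fix f :: "'k mpoly" assume "f \<in> inner_minors P"
  then obtain i j k l where "f = minor (i, j) (k, l)" "inner_interval P (i, j) (k, l)"
    by (auto simp: inner_minors_def)
  then show "f \<in> poly_ring (vertices P)"
    using inner_interval_corners[of P i j k l]
    by (auto simp: minor_def var_def intro!: poly_ring_diff poly_ring_mult)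
qed

text \<open>The coefficients of \<open>f\<close> over the fibre of its leading monomial sum to zero,
  so the fibre contains a second, smaller monomial of \<open>f\<close>, and
  \<open>fibre_not_minimal\<close> applies.\<close>

lemma lead_mono_polyomino_ideal:
  assumes "stack_polyomino P" "f \<in> polyomino_ideal P" "(f :: 'k::field mpoly) \<noteq> 0"
  shows "\<exists>k l i j. column_inner P k l i j \<and>
    mono_divides (lead k l i j) (lead_mono (lex_less (column_gt R)) f)"
proof -
  let ?m = "lead_mono (lex_less (column_gt R)) f"
  obtain j0 where flat: "flat_bottom P j0"
    using stack_polyomino_flat_bottom[OF assms(1)] .
  have conv: "row_convex P" and "finite (vertices P)"
    using assms(1) by (auto simp: stack_polyomino_def finite_vertices)
  then obtain N1 N2 where "\<forall>n\<in>fst ` vertices P. n < N1" "\<forall>n\<in>snd ` vertices P. n < N2"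
    by (meson finite_imageI finite_nat_set_iff_bounded)
  then have box: "vertices P \<subseteq> {..<max N1 N2} \<times> {..<max N1 N2}"
    by force
  let ?\<delta> = "box_sums (max N1 N2)"
  have "fibre_sum ?\<delta> (?\<delta> ?m) f = 0"
    using assms(2) unfolding polyomino_ideal_def
    by (rule ideal_generated_fibre_sum) (rule inner_minors_fibre_sum[OF box])
  moreover have m: "?m \<in> Poly_Mapping.keys f"
    using assms(3) by (rule lead_mono_in_keys)
  moreover have "fibre_sum ?\<delta> (?\<delta> ?m) f = Poly_Mapping.lookup f ?m"
    if "\<And>m'. m' \<in> Poly_Mapping.keys f \<Longrightarrow> ?\<delta> m' = ?\<delta> ?m \<Longrightarrow> m' = ?m"
  proof -
    have "{m' \<in> Poly_Mapping.keys f. ?\<delta> m' = ?\<delta> ?m} = {?m}"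
      using m that by blast
    then show ?thesis
      by (simp add: fibre_sum_def)
  qed
  ultimately obtain m' where m': "m' \<in> Poly_Mapping.keys f" "?\<delta> m' = ?\<delta> ?m" "m' \<noteq> ?m"
    by (auto simp: in_keys_iff)
  have "f \<in> poly_ring (vertices P)"
    using assms(2) ideal_generated_subset_poly_ring[OF inner_minors_subset_poly_ring]
    unfolding polyomino_ideal_def by blast
  then have "Poly_Mapping.keys ?m \<subseteq> vertices P" "Poly_Mapping.keys m' \<subseteq> vertices P"
    using m m' by (auto simp: poly_ring_def)
  then show ?thesis
    using fibre_not_minimal[OF conv flat box _ _ m'(2)] less_lead_mono[OF assms(3) m'(1,3)] by blast
qed

text \<open>Both variables of the divisor are among the two of \<open>m\<close>, so they are exactly
  these. In the divisor the earlier column carries the higher row, which rules out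
  \<open>lead i l k j\<close> and fixes all four indices.\<close>

lemma lead_divides_column_minor_key:
  assumes g: "R k i" "j < l" and h: "R k' i'" "j' < l'"
    and m: "m = lead k l i j \<or> m = lead i l k j" "mono_divides (lead k' l' i' j') m"
  shows "k' = k \<and> l' = l \<and> i' = i \<and> j' = j"
proof -
  have "k \<noteq> i" "k' \<noteq> i'" "\<not> R i k"
    using g h R_irrefl R_trans by blast+
  have "Poly_Mapping.lookup (lead k' l' i' j') (k', l') \<le> Poly_Mapping.lookup m (k', l')"
    and "Poly_Mapping.lookup (lead k' l' i' j') (i', j') \<le> Poly_Mapping.lookup m (i', j')"
    using m(2) unfolding mono_divides_def by blast+
  then have "Poly_Mapping.lookup m (k', l') \<noteq> 0" "Poly_Mapping.lookup m (i', j') \<noteq> 0"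
    by (auto simp: lookup_add)
  then show ?thesis
    using m(1) g h \<open>k \<noteq> i\<close> \<open>k' \<noteq> i'\<close> \<open>\<not> R i k\<close>
    by (auto simp: lookup_add lookup_single when_def split: if_splits)
qed

section \<open>The reduced Groebner basis\<close>

theorem reduced_groebner_basis_column_minors:
  assumes "stack_polyomino P"
  shows "reduced_groebner_basis (lex_less (column_gt R)) (vertices P) (polyomino_ideal P)
    (column_minors P :: 'k::field mpoly set)"
proof -
  let ?lm = "lead_mono (lex_less (column_gt R))" and ?I = "polyomino_ideal P :: 'k mpoly set"
  let ?in = "initial_ideal (lex_less (column_gt R)) (vertices P)"
  \<comment> \<open>Whatever \<open>lead_mono\<close> returns for the zero polynomial, the
    coefficient there is 0 and not 1.\<close>
  have nz: "(0 :: 'k mpoly) \<notin> column_minors P"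
    using leading_coeff_column_minors[of "0 :: 'k mpoly" P] by (auto simp: leading_coeff_def)
  have sub: "column_minors P \<subseteq> ?I"
  proof
    fix g :: "'k mpoly" assume "g \<in> column_minors P"
    then obtain f where "f \<in> inner_minors P" "g = 1 * f \<or> g = (- 1) * f"
      using column_minor_inner_minor by fastforce
    then show "g \<in> ?I"
      unfolding polyomino_ideal_def
      using ideal_generated_mult_generator[of 1 "vertices P" f "inner_minors P"]
        ideal_generated_mult_generator[of "- 1" "vertices P" f "inner_minors P"] by auto
  qed
  \<comment> \<open>It suffices to treat the generators of the initial ideal of \<open>?I\<close>:
    each is a multiple, within the ring, of the leading monomial of some column minor.\<close>
  have "monomial (?lm f) \<in> ?in (column_minors P :: 'k mpoly set)"
    if f: "f \<in> ?I" "f \<noteq> 0" for f :: "'k mpoly"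
  proof -
    obtain k l i j where g: "column_inner P k l i j" "mono_divides (lead k l i j) (?lm f)"
      using lead_mono_polyomino_ideal[OF assms f] by blast
    have "f \<in> poly_ring (vertices P)"
      using f(1) ideal_generated_subset_poly_ring[OF inner_minors_subset_poly_ring]
      unfolding polyomino_ideal_def by blast
    then have "Poly_Mapping.keys (?lm f) \<subseteq> vertices P"
      using lead_mono_in_keys[OF f(2)] by (auto simp: poly_ring_def)
    moreover have "column_minor k l i j \<in> (column_minors P :: 'k mpoly set)"
      using g(1) unfolding column_minors_def by blast
    moreover have "?lm (column_minor k l i j :: 'k mpoly) = lead k l i j"
      using column_inner_distinct[OF g(1)] lead_mono_column_minor by blast
    ultimately show ?thesis
      unfolding initial_ideal_def using g(2) nz
      by (intro monomial_in_ideal_if_divides[of "lead k l i j"]) (auto, metis)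
  qed
  then have "?in ?I \<subseteq> ?in (column_minors P)"
    unfolding initial_ideal_def by (intro ideal_generated_minimal) auto
  moreover have "?in (column_minors P) \<subseteq> ?in ?I"
    unfolding initial_ideal_def using sub
    by (intro ideal_generated_minimal) (auto intro!: ideal_generated_generator)
  ultimately have "groebner_basis (lex_less (column_gt R)) (vertices P) ?I (column_minors P)"
    using finite_column_minors assms nz sub
    by (auto simp: groebner_basis_def stack_polyomino_def)
  moreover have "\<not> mono_divides (?lm h) m"
    if gh: "g \<in> column_minors P" "h \<in> column_minors P" "h \<noteq> g" "m \<in> Poly_Mapping.keys g"
    for g h :: "'k mpoly" and m
  proof
    assume div: "mono_divides (?lm h) m"
    obtain k l i j where g: "g = column_minor k l i j" "R k i" "k \<noteq> i" "j < l"
      using gh(1) column_inner_distinct unfolding column_minors_def by blast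
    obtain k' l' i' j' where h: "h = column_minor k' l' i' j'" "R k' i'" "j' < l'"
      using gh(2) column_inner_distinct unfolding column_minors_def by blast
    have "m = lead k l i j \<or> m = lead i l k j"
      using gh(4) g column_minor_keys by blast
    moreover have "mono_divides (lead k' l' i' j') m"
      using div h lead_mono_column_minor by metis
    ultimately show False
      using lead_divides_column_minor_key g h gh(3) by metis
  qed
  ultimately show ?thesis
    using leading_coeff_column_minors unfolding reduced_groebner_basis_def by blast
qed

lemma reduced_groebner_basis_iff:
  assumes "stack_polyomino P"
  shows "reduced_groebner_basis (lex_less (column_gt R)) (vertices P)
    (polyomino_ideal P :: 'k::field mpoly set) G \<longleftrightarrow> G = column_minors P"
proof
  assume G: "reduced_groebner_basis (lex_less (column_gt R)) (vertices P) (polyomino_ideal P) G"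
  note H = reduced_groebner_basis_column_minors[OF assms, where 'k = 'k]
  have "f - g \<in> polyomino_ideal P" if "f \<in> polyomino_ideal P" "g \<in> polyomino_ideal P"
    for f g :: "'k mpoly"
    using that unfolding polyomino_ideal_def by (rule ideal_generated_diff)
  then show "G = column_minors P"
    using reduced_groebner_basis_subset[OF G H] reduced_groebner_basis_subset[OF H G] by blast
qed (simp add: reduced_groebner_basis_column_minors[OF assms])

end

section \<open>The two given orders: \<open>(<)\<close> makes columns further left greater,
  \<open>(>)\<close> those further right\<close>

interpretation left_order: column_order "(<)"
  by unfold_locales auto

interpretation right_order: column_order "(>)"
  by unfold_locales auto

lemma var_gt1_eq: "var_gt1 = column_gt (>)"
  by (intro ext) (auto simp: var_gt1_def column_gt_def)

lemma var_gt2_eq: "var_gt2 = column_gt (<)"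
  by (intro ext) (auto simp: var_gt2_def column_gt_def)

theorem corollary4p3:
  fixes P :: "cell set"
  assumes "stack_polyomino P"
  shows "\<forall>gt \<in> {var_gt1, var_gt2}.
    (\<exists>!G. reduced_groebner_basis (lex_less gt) (vertices P)
            (polyomino_ideal P :: 'k::field mpoly set) G) \<and>
    (\<forall>G. reduced_groebner_basis (lex_less gt) (vertices P)
            (polyomino_ideal P :: 'k::field mpoly set) G
         \<longrightarrow> equal_up_to_sign G (inner_minors P))"
  \<comment> \<open>Being reduced Groebner basis is equivalent to
    \<open>G = column_minors P\<close>, which gives existence, uniqueness and the sign statement
    together.\<close>
  by (simp add: Ex1_def var_gt1_eq var_gt2_eq left_order.reduced_groebner_basis_iff[OF assms]
      right_order.reduced_groebner_basis_iff[OF assms]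
      left_order.equal_up_to_sign_column_minors right_order.equal_up_to_sign_column_minors)

end
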